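(* Let $G=(V\cup E,\varepsilon)$ be the complete bipartite graph $K_{m,n}$ $(m\le n)$. Then (1) $I_G(x)=\sum_{i=0}^{m-1}\binom{n-1}{i}\binom{m-1}{i}x^{i}$; (2) $X_G(y)=\sum_{i=0}^{n-1}\binom{m+i-2}{i}y^{i}$ if we regard $E$ as the set of hyperedges.
   Context: $G=(V\cup E,\varepsilon)$ denotes a finite simple bipartite graph with non-empty colour classes $V$ and $E$ and edge set $\varepsilon$; the elements of $E$ are called hyperedges. $K_{m,n}$ is the complete bipartite graph whose colour classes have $m$ and $n$ vertices. For connected $G$, a hypertree of $G$ is a function $f:E\to\{0,1,2,\dots\}$ for which there is a spanning tree $\tau$ of $G$ with $d_\tau(e)=f(e)+1$ for every $e\in E$. For distinct $e,e'\in E$, we say that $e$ can transfer valence to $e'$ with respect to a hypertree $f$ if the function obtained from $f$ by decreasing $f(e)$ by 1 and increasing $f(e')$ by 1 is also a hypertree. Fix a total order on $E$. A hyperedge $e$ is internally inactive with respect to $f$ if there is $e'<e$ such that $e$ can transfer valence to $e'$ with respect to $f$, and externally inactive with respect to $f$ if there is $e'<e$ such that $e'$ can transfer valence to $e$ with respect to $f$. Let $\overline{\iota}(f)$ and $\overline{\epsilon}(f)$ be the numbers of internally, respectively externally, inactive hyperedges. The interior and exterior polynomials are $I_G(x)=\sum_f x^{\overline{\iota}(f)}$ and $X_G(y)=\sum_f y^{\overline{\epsilon}(f)}$, the sums being over all hypertrees $f$ of $G$. It is known that they do not depend on the order on $E$, and that $I_G$ does not depend on which of the two colour classes is taken as the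 set of hyperedges, whereas $X_G$ may depend on this choice. *)

theory Defs
  imports "HOL-Library.FuncSet" "HOL-Computational_Algebra.Polynomial"
begin

section \<open>Simple graphs\<close>

text \<open>An edge is the two-element set of its endpoints; the vertex set is given separately.\<close>

definition graph_connected :: "'a set \<Rightarrow> 'a set set \<Rightarrow> bool" where
  "graph_connected W T \<longleftrightarrow> W \<noteq> {} \<and> (\<forall>u\<in>W. \<forall>w\<in>W. (u, w) \<in> {(a, b). {a, b} \<in> T}\<^sup>*)"

definition is_cycle :: "'a set set \<Rightarrow> 'a list \<Rightarrow> bool" where
  "is_cycle T p \<longleftrightarrow> 3 \<le> length p \<and> distinct p \<and>
     (\<forall>i<length p. {p ! i, p ! (Suc i mod length p)} \<in> T)"

definition is_tree :: "'a set \<Rightarrow> 'a set set \<Rightarrow> bool" where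
  "is_tree W T \<longleftrightarrow> graph_connected W T \<and> (\<nexists>p. is_cycle T p)"

definition is_spanning_tree :: "'a set \<Rightarrow> 'a set set \<Rightarrow> 'a set set \<Rightarrow> bool" where
  "is_spanning_tree W \<epsilon> T \<longleftrightarrow> T \<subseteq> \<epsilon> \<and> is_tree W T"

definition degree_in :: "'a set set \<Rightarrow> 'a \<Rightarrow> nat" where
  "degree_in T x = card {a \<in> T. x \<in> a}"

section \<open>Bipartite graphs\<close>

definition bipartite_graph :: "'a set \<Rightarrow> 'a set \<Rightarrow> 'a set set \<Rightarrow> bool" where
  "bipartite_graph V E \<epsilon> \<longleftrightarrow>
     finite V \<and> finite E \<and> V \<noteq> {} \<and> E \<noteq> {} \<and> V \<inter> E = {} \<and>
     (\<forall>a\<in>\<epsilon>. \<exists>v\<in>V. \<exists>e\<in>E. a = {v, e})"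

definition complete_bipartite_graph ::
    "nat \<Rightarrow> nat \<Rightarrow> 'a set \<Rightarrow> 'a set \<Rightarrow> 'a set set \<Rightarrow> bool" where
  "complete_bipartite_graph m n V E \<epsilon> \<longleftrightarrow>
     bipartite_graph V E \<epsilon> \<and> card V = m \<and> card E = n \<and>
     (\<forall>v\<in>V. \<forall>e\<in>E. {v, e} \<in> \<epsilon>)"

section \<open>Hypertrees\<close>

text \<open>
  In everything below the second colour class is the set of hyperedges. As edges are unordered
  pairs, \<open>(E, V, \<epsilon>)\<close> is the same graph as \<open>(V, E, \<epsilon>)\<close> with \<open>V\<close> taken as the set of hyperedges.
  A function on \<open>E\<close> is a function that is \<open>undefined\<close> off \<open>E\<close>, so that distinct hypertrees differ
  on \<open>E\<close>.
\<close>

definition hypertree :: "'a set \<Rightarrow> 'a set \<Rightarrow> 'a set set \<Rightarrow> ('a \<Rightarrow> nat) \<Rightarrow> bool" where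
  "hypertree V E \<epsilon> f \<longleftrightarrow> f \<in> extensional E \<and>
     (\<exists>T. is_spanning_tree (V \<union> E) \<epsilon> T \<and> (\<forall>e\<in>E. degree_in T e = f e + 1))"

text \<open>
  The condition \<open>1 \<le> f e\<close> says that the decreased value is still a natural number; without it,
  truncated subtraction would leave \<open>f e\<close> unchanged at \<open>0\<close>.
\<close>

definition can_transfer ::
    "'a set \<Rightarrow> 'a set \<Rightarrow> 'a set set \<Rightarrow> ('a \<Rightarrow> nat) \<Rightarrow> 'a \<Rightarrow> 'a \<Rightarrow> bool" where
  "can_transfer V E \<epsilon> f e e' \<longleftrightarrow> e \<in> E \<and> e' \<in> E \<and> e \<noteq> e' \<and>
     1 \<le> f e \<and> hypertree V E \<epsilon> (f(e := f e - 1, e' := f e' + 1))"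

text \<open>
  The order on \<open>E\<close> is a reflexive linear order \<open>r\<close>; \<open>(e', e) \<in> r\<close> stands for \<open>e' \<le> e\<close>.
\<close>

definition internally_inactive ::
    "'a set \<Rightarrow> 'a set \<Rightarrow> 'a set set \<Rightarrow> 'a rel \<Rightarrow> ('a \<Rightarrow> nat) \<Rightarrow> 'a \<Rightarrow> bool" where
  "internally_inactive V E \<epsilon> r f e \<longleftrightarrow>
     (\<exists>e'\<in>E. (e', e) \<in> r \<and> e' \<noteq> e \<and> can_transfer V E \<epsilon> f e e')"

definition externally_inactive ::
    "'a set \<Rightarrow> 'a set \<Rightarrow> 'a set set \<Rightarrow> 'a rel \<Rightarrow> ('a \<Rightarrow> nat) \<Rightarrow> 'a \<Rightarrow> bool" where
  "externally_inactive V E \<epsilon> r f e \<longleftrightarrow>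
     (\<exists>e'\<in>E. (e', e) \<in> r \<and> e' \<noteq> e \<and> can_transfer V E \<epsilon> f e' e)"

section \<open>The interior and exterior polynomials\<close>

lemma finite_hypertrees:
  assumes "bipartite_graph V E \<epsilon>"
  shows "finite {f. hypertree V E \<epsilon> f}"
proof (rule finite_subset)
  define g where "g T = (\<lambda>e. if e \<in> E then degree_in T e - 1 else undefined)" for T :: "'a set set"
  have fin: "finite V" "finite E" and edge: "\<forall>a\<in>\<epsilon>. \<exists>v\<in>V. \<exists>e\<in>E. a = {v, e}"
    using assms unfolding bipartite_graph_def by iprover+
  have "a \<in> Pow (V \<union> E)" if "a \<in> \<epsilon>" for a
    using bspec[OF edge that] by (elim bexE) simp
  then have "\<epsilon> \<subseteq> Pow (V \<union> E)" by (rule subsetI)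
  moreover have "finite (Pow (V \<union> E))"
    using fin by simp
  ultimately have "finite \<epsilon>"
    by (rule finite_subset)
  then show "finite (g ` Pow \<epsilon>)" by simp
  show "{f. hypertree V E \<epsilon> f} \<subseteq> g ` Pow \<epsilon>"
  proof
    fix f assume "f \<in> {f. hypertree V E \<epsilon> f}"
    then obtain T where T: "T \<subseteq> \<epsilon>" "\<forall>e\<in>E. degree_in T e = f e + 1" "f \<in> extensional E"
      unfolding mem_Collect_eq hypertree_def is_spanning_tree_def by iprover
    have "f = g T"
    proof
      fix x show "f x = g T x"
        using bspec[OF T(2)] extensional_arb[OF T(3)] by (cases "x \<in> E") (simp_all add: g_def)
    qed
    moreover have "T \<in> Pow \<epsilon>" using T(1) by simp
    ultimately show "f \<in> g ` Pow \<epsilon>" by (rule image_eqI)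
  qed
qed

definition interior_poly ::
    "'a set \<Rightarrow> 'a set \<Rightarrow> 'a set set \<Rightarrow> 'a rel \<Rightarrow> int poly" where
  "interior_poly V E \<epsilon> r =
     (\<Sum>f | hypertree V E \<epsilon> f. monom 1 (card {e \<in> E. internally_inactive V E \<epsilon> r f e}))"

definition exterior_poly ::
    "'a set \<Rightarrow> 'a set \<Rightarrow> 'a set set \<Rightarrow> 'a rel \<Rightarrow> int poly" where
  "exterior_poly V E \<epsilon> r =
     (\<Sum>f | hypertree V E \<epsilon> f. monom 1 (card {e \<in> E. externally_inactive V E \<epsilon> r f e}))"

end

theory Submission
  imports Defs
begin

text \<open>
  In $K_{m,n}$ the hypertrees on $E$ are exactly the functions $f : E \to \{0, 1, 2, \dots\}$ with
  $\sum_e f(e) = m - 1$: every spanning tree has $m + n - 1$ edges, and conversely a tree with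
  prescribed degrees in $E$ is built greedily by attaching leaves. Hence $e$ can transfer
  valence to every other hyperedge as soon as $f(e) > 0$. So $\overline{\iota}(f)$ counts the
  elements of the support of $f$ other than the smallest hyperedge, and $\overline{\epsilon}(f)$
  counts the hyperedges above the smallest element of the support.
\<close>

section \<open>Trees\<close>

abbreviation adjacency :: "'a set set \<Rightarrow> 'a rel" where
  "adjacency T \<equiv> {(a, b). {a, b} \<in> T}"

lemma adjacency_rtrancl_sym: "(u, v) \<in> (adjacency T)\<^sup>* \<Longrightarrow> (v, u) \<in> (adjacency T)\<^sup>*"
  by (rule symD[OF sym_rtrancl]) (auto simp: sym_def insert_commute)

lemma adjacency_insert: "adjacency (insert {u, v} T) = insert (u, v) (insert (v, u) (adjacency T))"
  by (auto simp: doubleton_eq_iff)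

text \<open>A path is extended one edge at a time. If the new endpoint \<open>c\<close> already lies
  on it, the path is cut back to the occurrence of \<open>c\<close>, which keeps it free of
  repetitions.\<close>

lemma rtrancl_imp_distinct_path:
  assumes "(u, v) \<in> (adjacency T)\<^sup>*"
  shows "\<exists>p. p \<noteq> [] \<and> hd p = u \<and> last p = v \<and> distinct p \<and> successively (\<lambda>a b. {a, b} \<in> T) p"
  using assms
proof (induction rule: rtrancl_induct)
  case base
  show ?case by (rule exI[of _ "[u]"]) simp
next
  case (step b c)
  then obtain p where p: "p \<noteq> []" "hd p = u" "last p = b" "distinct p"
    "successively (\<lambda>a b. {a, b} \<in> T) p" by blast
  show ?case
  proof (cases "c \<in> set p")
    case True
    then obtain q q' where q: "p = q @ c # q'" by (meson split_list)
    have "hd (q @ [c]) = u" using p(2) q by (cases q) auto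
    with p q show ?thesis
      by (intro exI[of _ "q @ [c]"]) (auto simp: successively_append_iff)
  next
    case False
    with p step show ?thesis
      by (intro exI[of _ "p @ [c]"]) (auto simp: successively_append_iff)
  qed
qed

text \<open>The new edge closes a repetition-free path from \<open>u\<close> to \<open>v\<close>.
  Since \<open>u\<close> and \<open>v\<close> are distinct and not yet adjacent, that path has at
  least three vertices, as \<open>is_cycle\<close> demands.\<close>

lemma closed_path_is_cycle:
  assumes uv: "(u, v) \<in> (adjacency T)\<^sup>*" and "u \<noteq> v" "{u, v} \<notin> T"
  shows "\<exists>p. is_cycle (insert {u, v} T) p"
proof -
  obtain p where p: "p \<noteq> []" "hd p = u" "last p = v" "distinct p"
    "successively (\<lambda>a b. {a, b} \<in> T) p" using rtrancl_imp_distinct_path[OF uv] by blast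
  have len: "3 \<le> length p"
  proof (rule ccontr)
    assume "\<not> 3 \<le> length p"
    then consider "length p = 0" | "length p = 1" | "length p = 2" by linarith
    then show False using p assms(2,3)
      by cases (auto simp: length_Suc_conv numeral_2_eq_2)
  qed
  have "{p ! i, p ! (Suc i mod length p)} \<in> insert {u, v} T" if "i < length p" for i
  proof (cases "Suc i < length p")
    case True
    then show ?thesis using p(5) by (auto simp: successively_conv_nth)
  next
    \<comment> \<open>Only the last index wraps around; its edge joins \<open>last p = v\<close> to
      \<open>hd p = u\<close> and is the inserted one.\<close>
    case False
    then have "i = length p - 1" using that by simp
    moreover have "Suc i = length p" using False that by simp
    ultimately show ?thesis using p by (auto simp: hd_conv_nth last_conv_nth)
  qed
  with p len show ?thesis unfolding is_cycle_def by blast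
qed

lemma is_cycle_mono: "is_cycle S p \<Longrightarrow> S \<subseteq> T \<Longrightarrow> is_cycle T p"
  unfolding is_cycle_def by blast

text \<open>The map \<open>\<phi>\<close> labels the connected components, so that \<open>card (\<phi> ` W)\<close> is their number.\<close>

lemma forest_component_labelling:
  assumes "finite T" "finite W" "\<And>a. a \<in> T \<Longrightarrow> \<exists>u\<in>W. \<exists>v\<in>W. u \<noteq> v \<and> a = {u, v}"
    and "\<nexists>p. is_cycle T p"
  shows "\<exists>\<phi> :: 'a \<Rightarrow> 'a. (\<forall>a b. \<phi> a = \<phi> b \<longleftrightarrow> (a, b) \<in> (adjacency T)\<^sup>*) \<and>
           card (\<phi> ` W) + card T = card W"
  using assms(1,3,4)
proof (induction T rule: finite_induct)
  case empty
  show ?case by (rule exI[of _ id]) auto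
next
  case (insert a T)
  obtain u v where uv: "u \<in> W" "v \<in> W" "u \<noteq> v" "a = {u, v}" using insert.prems(1) by blast
  have "\<nexists>p. is_cycle T p" using insert.prems(2) is_cycle_mono by blast
  then obtain \<phi> :: "'a \<Rightarrow> 'a" where \<phi>: "\<And>a b. \<phi> a = \<phi> b \<longleftrightarrow> (a, b) \<in> (adjacency T)\<^sup>*"
    and card: "card (\<phi> ` W) + card T = card W" using insert.IH insert.prems(1) by blast
  \<comment> \<open>An edge inside one component would close a cycle, so the new edge joins two
    components.\<close>
  have ne: "\<phi> u \<noteq> \<phi> v"
    using closed_path_is_cycle[of u v T] uv insert.hyps insert.prems(2) \<phi> by blast
  \<comment> \<open>\<open>\<psi>\<close> merges the component of \<open>v\<close> into that of
    \<open>u\<close>. Exactly the label \<open>\<phi> v\<close> disappears, which balances the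
    additional edge.\<close>
  define \<psi> where "\<psi> w = (if \<phi> w = \<phi> v then \<phi> u else \<phi> w)" for w
  have "\<psi> x = \<psi> y \<longleftrightarrow> (x, y) \<in> (adjacency (insert a T))\<^sup>*" for x y
    \<comment> \<open>\<open>rtrancl_insert\<close> is needed once for each orientation of the new
      edge; reachability in \<open>T\<close> is then read off the labels.\<close>
    unfolding uv(4) adjacency_insert rtrancl_insert
    using \<phi>[symmetric] by (auto simp: \<psi>_def rtrancl_insert \<phi>[symmetric])
  moreover have "\<psi> ` W = \<phi> ` W - {\<phi> v}"
    using ne uv by (auto simp: \<psi>_def image_iff)
  then have "card (\<psi> ` W) + 1 = card (\<phi> ` W)"
    using uv assms(2) by (simp add: card_Diff_singleton card_gt_0_iff Suc_leI)
      (metis card_gt_0_iff emptyE finite_imageI imageI Suc_pred)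
  ultimately show ?case using card insert.hyps by (intro exI[of _ \<psi>]) auto
qed

text \<open>Connectedness leaves a single component label.\<close>

lemma tree_card_edges:
  assumes "is_tree W T" "finite T" "finite W"
    and "\<And>a. a \<in> T \<Longrightarrow> \<exists>u\<in>W. \<exists>v\<in>W. u \<noteq> v \<and> a = {u, v}"
  shows "card T + 1 = card W"
proof -
  have conn: "W \<noteq> {}" "\<And>u v. u \<in> W \<Longrightarrow> v \<in> W \<Longrightarrow> (u, v) \<in> (adjacency T)\<^sup>*"
    and "\<nexists>p. is_cycle T p"
    using assms(1) unfolding is_tree_def graph_connected_def by blast+
  then obtain \<phi> :: "'a \<Rightarrow> 'a" where \<phi>: "\<And>a b. \<phi> a = \<phi> b \<longleftrightarrow> (a, b) \<in> (adjacency T)\<^sup>*"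
    and card: "card (\<phi> ` W) + card T = card W"
    using forest_component_labelling[OF assms(2,3,4)] by blast
  obtain w where "w \<in> W" using conn(1) by blast
  then have "\<phi> ` W = {\<phi> w}" using conn(2) \<phi> by auto
  with card show ?thesis by simp
qed

section \<open>Growing trees with prescribed degrees\<close>

lemma is_tree_singleton: "is_tree {v} {}"
  by (auto simp: is_tree_def graph_connected_def is_cycle_def intro!: exI[of _ 0])

text \<open>A cycle through \<open>x\<close> would need two different neighbours of
  \<open>x\<close>, but \<open>y\<close> is the only one; a cycle avoiding \<open>x\<close> already
  lies in \<open>T\<close>.\<close>

lemma is_tree_insert_leaf:
  assumes "is_tree W T" "x \<notin> W" "y \<in> W" "T \<subseteq> Pow W"
  shows "is_tree (insert x W) (insert {x, y} T)"
  unfolding is_tree_def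
proof
  have conn: "\<And>u v. u \<in> W \<Longrightarrow> v \<in> W \<Longrightarrow> (u, v) \<in> (adjacency T)\<^sup>*" and acyc: "\<nexists>p. is_cycle T p"
    using assms(1) unfolding is_tree_def graph_connected_def by blast+
  let ?R = "adjacency (insert {x, y} T)"
  have to_y: "(u, y) \<in> ?R\<^sup>*" if "u \<in> insert x W" for u
  proof (cases "u = x")
    case True
    then show ?thesis by (intro r_into_rtrancl) simp
  next
    case False
    then have "(u, y) \<in> (adjacency T)\<^sup>*" using that assms(3) conn by blast
    moreover have "(adjacency T)\<^sup>* \<subseteq> ?R\<^sup>*" by (rule rtrancl_mono) auto
    ultimately show ?thesis by blast
  qed
  have "(u, w) \<in> ?R\<^sup>*" if "u \<in> insert x W" "w \<in> insert x W" for u w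
    using rtrancl_trans[OF to_y[OF that(1)] adjacency_rtrancl_sym[OF to_y[OF that(2)]]] .
  then show "graph_connected (insert x W) (insert {x, y} T)"
    unfolding graph_connected_def by blast
  show "\<nexists>p. is_cycle (insert {x, y} T) p"
  proof
    assume "\<exists>p. is_cycle (insert {x, y} T) p"
    then obtain p where p: "3 \<le> length p" "distinct p"
      "\<And>i. i < length p \<Longrightarrow> {p ! i, p ! (Suc i mod length p)} \<in> insert {x, y} T"
      unfolding is_cycle_def by blast
    have nbr: "z = y" if "{x, z} \<in> insert {x, y} T" for z
      using that assms(2,4) by (auto simp: doubleton_eq_iff)
    show False
    proof (cases "x \<in> set p")
      case True
      let ?n = "length p"
      obtain i where i: "i < ?n" "p ! i = x" using True by (auto simp: in_set_conv_nth)
      \<comment> \<open>\<open>j\<close> is the cyclic predecessor of \<open>i\<close>. Both cyclic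
        neighbours of \<open>x\<close> equal \<open>y\<close>, so their positions coincide, which
        length at least 3 forbids.\<close>
      define j where "j = (if i = 0 then ?n - 1 else i - 1)"
      have j: "j < ?n" "Suc j mod ?n = i" using i p(1) by (auto simp: j_def)
      have k: "Suc i mod ?n < ?n" using p(1) by (intro mod_less_divisor) linarith
      have "p ! (Suc i mod ?n) = y" using p(3)[OF i(1)] i nbr by simp
      moreover have "p ! j = y" using p(3)[OF j(1)] i j nbr by (simp add: insert_commute)
      ultimately have "j = Suc i mod ?n" using nth_eq_iff_index_eq[OF p(2) j(1) k] by simp
      then show False using p(1) i(1) by (auto simp: j_def mod_Suc split: if_splits)
    next
      case False
      have "{p ! i, p ! (Suc i mod length p)} \<in> T" if "i < length p" for i
      proof -
        have "Suc i mod length p < length p" using p(1) by (intro mod_less_divisor) linarith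
        then have "p ! i \<noteq> x" "p ! (Suc i mod length p) \<noteq> x"
          using False that nth_mem by metis+
        then show ?thesis using p(3)[OF that] by (auto simp: doubleton_eq_iff)
      qed
      then show False using acyc p unfolding is_cycle_def by blast
    qed
  qed
qed

lemma is_tree_attach_leaves:
  assumes "finite L" "is_tree W T" "L \<inter> W = {}" "y \<in> W" "T \<subseteq> Pow W"
  shows "is_tree (L \<union> W) ((\<lambda>x. {x, y}) ` L \<union> T)"
  using assms(1,3)
proof (induction L rule: finite_induct)
  case empty
  then show ?case using assms by simp
next
  case (insert x L)
  have "is_tree (insert x (L \<union> W)) (insert {x, y} ((\<lambda>x. {x, y}) ` L \<union> T))"
    using insert assms by (intro is_tree_insert_leaf) auto
  then show ?case by simp
qed

text \<open>Each new hyperedge \<open>e\<close> receives \<open>f e\<close> private leaves from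
  \<open>V\<close> and one further edge to the tree on the remaining vertices. Removing these leaves
  preserves the cardinality condition, and the final \<open>+ 1\<close> always leaves a vertex to
  attach to.\<close>

lemma exists_bipartite_tree_with_degrees:
  fixes f :: "'a \<Rightarrow> nat"
  assumes "finite E" "finite V" "V \<inter> E = {}" "card V = sum f E + 1"
  shows "\<exists>T. is_tree (V \<union> E) T \<and> T \<subseteq> {{v, e} | v e. v \<in> V \<and> e \<in> E} \<and>
    (\<forall>e\<in>E. degree_in T e = f e + 1)"
  using assms
proof (induction E arbitrary: V rule: finite_induct)
  case empty
  then obtain v where "V = {v}" by (auto simp: card_1_singleton_iff)
  then show ?case using is_tree_singleton[of v] by (intro exI[of _ "{}"]) auto
next
  case (insert e E)
  have "f e \<le> card V" using insert.hyps insert.prems by simp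
  then obtain L where L: "L \<subseteq> V" "card L = f e" "finite L" by (meson obtain_subset_with_card_n)
  define U where "U = V - L"
  have U: "finite U" "U \<inter> E = {}" "card U = sum f E + 1" "V = L \<union> U" "L \<inter> U = {}"
    using insert.hyps insert.prems L by (auto simp: U_def card_Diff_subset)
  then obtain T where T: "is_tree (U \<union> E) T" "T \<subseteq> {{v, e} | v e. v \<in> U \<and> e \<in> E}"
    "\<And>e. e \<in> E \<Longrightarrow> degree_in T e = f e + 1" using insert.IH[of U] by auto
  obtain u where u: "u \<in> U" using U(3) by fastforce
  have e: "e \<notin> V" "L \<inter> E = {}" "e \<notin> E" using insert.hyps insert.prems L by auto
  let ?T = "(\<lambda>x. {x, e}) ` L \<union> insert {e, u} T"
  \<comment> \<open>First \<open>e\<close> is a leaf at \<open>u\<close>; then the vertices of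
    \<open>L\<close> become leaves at \<open>e\<close>.\<close>
  have "is_tree (insert e (U \<union> E)) (insert {e, u} T)"
    using T u e U by (intro is_tree_insert_leaf) auto
  then have "is_tree (L \<union> insert e (U \<union> E)) ?T"
    using T u e U L by (intro is_tree_attach_leaves) auto
  then have "is_tree (V \<union> insert e E) ?T" using U by (simp add: Un_assoc)
  moreover have "?T \<subseteq> {{v, d} | v d. v \<in> V \<and> d \<in> insert e E}"
  proof -
    have "{e, u} = {u, e}" by auto
    with T(2) U(4) u show ?thesis by blast
  qed
  moreover have "degree_in ?T d = f d + 1" if "d \<in> insert e E" for d
  proof (cases "d = e")
    case True
    \<comment> \<open>The edges at \<open>e\<close> correspond to its neighbours: the leaves
      \<open>L\<close> and the attaching vertex \<open>u\<close>.\<close>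
    have "{a \<in> ?T. d \<in> a} = (\<lambda>x. {x, e}) ` insert u L"
      using True T(2) e U by (auto simp: insert_commute)
    moreover have "inj_on (\<lambda>x. {x, e}) (insert u L)" by (auto simp: inj_on_def doubleton_eq_iff)
    moreover have "card (insert u L) = f e + 1" using u U L by (auto simp: card_insert_if)
    ultimately show ?thesis using True by (simp add: degree_in_def card_image del: insert_iff image_insert)
  next
    case False
    then have "d \<in> E" using that by simp
    moreover have "{a \<in> ?T. d \<in> a} = {a \<in> T. d \<in> a}" using \<open>d \<in> E\<close> False e U u by auto
    ultimately show ?thesis using T(3) by (simp add: degree_in_def)
  qed
  ultimately show ?case by blast
qed

section \<open>Functions with a given sum\<close>

text \<open>Weak compositions of \<open>N\<close> with parts indexed by \<open>A\<close>.
  Extensionality matches the convention for hypertrees and makes the set finite for finite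
  \<open>A\<close>.\<close>

definition functions_with_sum :: "'a set \<Rightarrow> nat \<Rightarrow> ('a \<Rightarrow> nat) set" where
  "functions_with_sum A N = {f \<in> extensional A. sum f A = N}"

lemma functions_with_sum_empty:
  "functions_with_sum {} N = (if N = 0 then {\<lambda>_. undefined} else {})"
  by (auto simp: functions_with_sum_def)

lemma finite_functions_with_sum: "finite A \<Longrightarrow> finite (functions_with_sum A N)"
  by (rule finite_subset[OF _ finite_PiE[of A "\<lambda>_. {..N}"]])
    (auto simp: functions_with_sum_def PiE_def intro: member_le_sum)

text \<open>The value \<open>k\<close> at \<open>a\<close> is split off, leaving a weak composition
  of \<open>N - k\<close> on \<open>A\<close>. This recursion drives all the counts below.\<close>

lemma sum_functions_with_sum_insert:
  fixes F :: "('a \<Rightarrow> nat) \<Rightarrow> 'b::comm_monoid_add"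
  assumes "finite A" "a \<notin> A"
  shows "(\<Sum>f\<in>functions_with_sum (insert a A) N. F f) =
         (\<Sum>k\<le>N. \<Sum>g\<in>functions_with_sum A (N - k). F (g(a := k)))"
proof -
  have "(\<Sum>f\<in>functions_with_sum (insert a A) N. F f) =
    (\<Sum>(k, g)\<in>(SIGMA k:{..N}. functions_with_sum A (N - k)). F (g(a := k)))"
  \<comment> \<open>Resetting the value at \<open>a\<close> to \<open>undefined\<close> makes the
    remaining function extensional on \<open>A\<close>.\<close>
  proof (rule sum.reindex_bij_witness[where
        i = "\<lambda>(k, g). g(a := k)" and j = "\<lambda>f. (f a, f(a := undefined))"])
    fix f assume f: "f \<in> functions_with_sum (insert a A) N"
    have "sum (f(a := undefined)) A = sum f A" using assms by (intro sum.cong) auto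
    then show "(f a, f(a := undefined)) \<in> (SIGMA k:{..N}. functions_with_sum A (N - k))"
      using f assms by (auto simp: functions_with_sum_def extensional_def)
  next
    fix x assume x: "x \<in> (SIGMA k:{..N}. functions_with_sum A (N - k))"
    obtain k g where kg: "x = (k, g)" by force
    have "sum (g(a := k)) A = sum g A" using assms by (intro sum.cong) auto
    then show "(case x of (k, g) \<Rightarrow> g(a := k)) \<in> functions_with_sum (insert a A) N"
      using x kg assms by (auto simp: functions_with_sum_def extensional_def)
    show "((case x of (k, g) \<Rightarrow> g(a := k)) a, (case x of (k, g) \<Rightarrow> g(a := k))(a := undefined)) = x"
      using x kg assms by (auto simp: functions_with_sum_def extensional_def)
  qed auto
  also have "\<dots> = (\<Sum>k\<le>N. \<Sum>g\<in>functions_with_sum A (N - k). F (g(a := k)))"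
    using assms by (subst sum.Sigma) (auto simp: finite_functions_with_sum)
  finally show ?thesis .
qed

lemma card_functions_with_sum_insert:
  assumes "finite A" "a \<notin> A"
  shows "card (functions_with_sum (insert a A) N) = (\<Sum>j\<le>N. card (functions_with_sum A j))"
proof -
  have "card (functions_with_sum (insert a A) N) = (\<Sum>k\<le>N. card (functions_with_sum A (N - k)))"
    using sum_functions_with_sum_insert[OF assms, of "\<lambda>_. 1 :: nat" N] by simp
  also have "\<dots> = (\<Sum>j\<le>N. card (functions_with_sum A j))"
    by (rule sum.reindex_bij_witness[where i = "\<lambda>k. N - k" and j = "\<lambda>k. N - k"]) auto
  finally show ?thesis .
qed

text \<open>Stars and bars for \<open>card A + 1\<close> parts. Singling out \<open>a\<close> avoids
  a truncated \<open>card A - 1\<close>.\<close>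

lemma card_functions_with_sum:
  assumes "finite A" "a \<notin> A"
  shows "card (functions_with_sum (insert a A) N) = (N + card A) choose card A"
  using assms
proof (induction A arbitrary: N rule: finite_induct)
  case empty
  have "(\<Sum>j\<le>N. card (functions_with_sum {} j :: ('a \<Rightarrow> nat) set)) =
    (\<Sum>j\<le>N. if j = 0 then 1 else 0)"
    by (intro sum.cong) (auto simp: functions_with_sum_empty)
  then show ?case by (simp add: card_functions_with_sum_insert)
next
  case (insert b A)
  have "card (functions_with_sum (insert b (insert a A)) N) =
    (\<Sum>j\<le>N. (j + card A) choose card A)"
    using insert.IH insert.hyps insert.prems by (subst card_functions_with_sum_insert) auto
  \<comment> \<open>Hockey-stick identity.\<close>
  also have "\<dots> = (N + card A + 1) choose (card A + 1)"
    by (induction N) auto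
  finally show ?case using insert.hyps insert.prems by (simp add: insert_commute)
qed

text \<open>This is the count for the interior polynomial, with \<open>a\<close> as the smallest
  hyperedge. Choose the \<open>i\<close> support elements in \<open>A\<close>; there are
  \<open>N choose i\<close> ways to give them positive values of total at most \<open>N\<close>, and
  \<open>a\<close> absorbs the rest. The induction separates value zero from positive values at a
  new element \<open>b\<close>.\<close>

lemma card_functions_with_sum_support:
  assumes "finite A" "a \<notin> A"
  shows "(\<Sum>f\<in>functions_with_sum (insert a A) N. of_bool (card {e \<in> A. 1 \<le> f e} = i)) =
    (card A choose i) * (N choose i)"
  using assms
proof (induction A arbitrary: N i rule: finite_induct)
  case empty
  show ?case using card_functions_with_sum[of "{}" a N] by (cases i) auto
next
  case (insert b A)
  let ?S = "\<lambda>N i. \<Sum>f\<in>functions_with_sum (insert a A) N. of_bool (card {e \<in> A. 1 \<le> f e} = i) :: nat"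
  have IH: "?S N i = (card A choose i) * (N choose i)" for N i using insert.IH insert.prems by auto
  let ?F = "\<lambda>f. of_bool (card {e \<in> insert b A. 1 \<le> f e} = i) :: nat"
  have zero: "?F (g(b := 0)) = of_bool (card {e \<in> A. 1 \<le> g e} = i)" for g :: "'a \<Rightarrow> nat"
  proof -
    have "{e \<in> insert b A. 1 \<le> (g(b := 0)) e} = {e \<in> A. 1 \<le> g e}" using insert.hyps insert.prems by auto
    then show ?thesis by simp
  qed
  have Suc: "?F (g(b := Suc k)) = of_bool (Suc (card {e \<in> A. 1 \<le> g e}) = i)"
    for g :: "'a \<Rightarrow> nat" and k
  proof -
    have "{e \<in> insert b A. 1 \<le> (g(b := Suc k)) e} = insert b {e \<in> A. 1 \<le> g e}"
      using insert.hyps insert.prems by auto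
    then show ?thesis using insert.hyps insert.prems by simp
  qed
  have "(\<Sum>f\<in>functions_with_sum (insert b (insert a A)) N. ?F f) =
    (\<Sum>k\<le>N. \<Sum>g\<in>functions_with_sum (insert a A) (N - k). ?F (g(b := k)))"
    using insert.hyps insert.prems by (intro sum_functions_with_sum_insert) auto
  also have "\<dots> = ?S N i +
      (\<Sum>k<N. \<Sum>g\<in>functions_with_sum (insert a A) (N - Suc k). ?F (g(b := Suc k)))"
    by (subst sum.atMost_shift) (simp only: zero diff_zero)
  \<comment> \<open>A positive value at \<open>b\<close> adds one support element whatever its size,
    so only the remaining total matters; the summation is reversed to run over that total.\<close>
  also have "(\<Sum>k<N. \<Sum>g\<in>functions_with_sum (insert a A) (N - Suc k). ?F (g(b := Suc k))) =
      (\<Sum>k<N. \<Sum>g\<in>functions_with_sum (insert a A) k. of_bool (Suc (card {e \<in> A. 1 \<le> g e}) = i))"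
    unfolding Suc by (rule sum.nat_diff_reindex)
  also have "?S N i + \<dots> = (card (insert b A) choose i) * (N choose i)"
  proof (cases i)
    case 0
    then show ?thesis using IH[where N = N and i = 0] by simp
  next
    case (Suc i')
    have "(\<Sum>k<N. ?S k i') = (card A choose i') * (\<Sum>k<N. k choose i')"
      unfolding IH sum_distrib_left ..
    \<comment> \<open>The hockey-stick identity makes \<open>N choose i\<close> a common factor;
      Pascal's rule for \<open>card A\<close> finishes the step.\<close>
    also have "(\<Sum>k<N. k choose i') = N choose Suc i'"
      by (induction N) auto
    finally show ?thesis using IH[where N = N and i = i] insert.hyps Suc by (simp add: algebra_simps)
  qed
  finally show ?case by (simp add: insert_commute)
qed

section \<open>Counting by the least element of the support\<close>

lemma linear_order_on_finite_least:
  assumes "linear_order_on E r" "finite A" "A \<noteq> {}" "A \<subseteq> E"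
  shows "\<exists>a\<in>A. \<forall>b\<in>A. (a, b) \<in> r"
  using assms(2-)
proof (induction A rule: finite_ne_induct)
  case (singleton x)
  then show ?case using assms(1)
    by (auto simp: order_on_defs refl_on_def)
next
  case (insert x A)
  then obtain a where a: "a \<in> A" "\<forall>b\<in>A. (a, b) \<in> r" by auto
  have "refl_on E r" "total_on E r" "trans r" using assms(1) by (auto simp: order_on_defs)
  moreover have "x \<in> E" "a \<in> E" using a(1) insert.prems by blast+
  ultimately have "(x, a) \<in> r \<or> (a, x) \<in> r" "(x, x) \<in> r"
    unfolding total_on_def refl_on_def by metis+
  with a \<open>trans r\<close> show ?case by (auto dest: transD)
qed

text \<open>As \<open>1 \<le> N\<close>, the support has a least element, and the counted elements
  are those above it. If there are \<open>i\<close> of them, one unit is reserved for the least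
  element and the other \<open>N - 1\<close> units are distributed freely over \<open>i + 1\<close>
  elements.\<close>

lemma card_functions_with_sum_above:
  assumes r: "linear_order_on E r" and "finite A" "A \<subseteq> E" "1 \<le> N"
  shows "(\<Sum>f\<in>functions_with_sum A N.
      of_bool (card {e \<in> A. \<exists>e'\<in>A. (e', e) \<in> r \<and> e' \<noteq> e \<and> 1 \<le> f e'} = i)) =
    (if i < card A then (N - 1 + i) choose i else 0)"
  using assms(2,3)
\<comment> \<open>The induction is on the cardinality because the element removed has to be the
  least one of \<open>A\<close>.\<close>
proof (induction "card A" arbitrary: A)
  case 0
  then show ?case using assms(4) by (simp add: functions_with_sum_empty)
next
  case (Suc d)
  then obtain a where a: "a \<in> A" "\<forall>b\<in>A. (a, b) \<in> r"
    using linear_order_on_finite_least[OF r, of A] by force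
  define B where "B = A - {a}"
  have B: "finite B" "a \<notin> B" "A = insert a B" "card B = d" "B \<subseteq> E"
    using a Suc by (auto simp: B_def)
  have anti: "(b, a) \<notin> r" if "b \<in> B" for b
    using that a B r by (metis order_on_defs(1-3) antisymD insertCI)
  let ?I = "\<lambda>A f. {e \<in> A. \<exists>e'\<in>A. (e', e) \<in> r \<and> e' \<noteq> e \<and> 1 \<le> (f e' :: nat)}"
  let ?F = "\<lambda>f. of_bool (card (?I A f) = i) :: nat"
  have zero: "?F (g(a := 0)) = of_bool (card (?I B g) = i)" for g
  proof -
    have "?I A (g(a := 0)) = ?I B g" using B(2,3) anti by auto metis
    then show ?thesis by simp
  qed
  \<comment> \<open>With a positive value at the least element \<open>a\<close>, all of
    \<open>B\<close> is counted, independently of \<open>g\<close>.\<close>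
  have Suc': "?F (g(a := Suc k)) = of_bool (d = i)" for g k
  proof -
    have "?I A (g(a := Suc k)) = B" using B a(2) anti by auto
    then show ?thesis using B by simp
  qed
  have "(\<Sum>f\<in>functions_with_sum A N. ?F f) =
    (\<Sum>k\<le>N. \<Sum>g\<in>functions_with_sum B (N - k). ?F (g(a := k)))"
    unfolding B(3) by (rule sum_functions_with_sum_insert[OF B(1,2)])
  also have "\<dots> = (\<Sum>g\<in>functions_with_sum B N. of_bool (card (?I B g) = i)) +
      (\<Sum>k<N. \<Sum>g\<in>functions_with_sum B (N - Suc k). ?F (g(a := Suc k)))"
    by (subst sum.atMost_shift) (simp only: zero diff_zero)
  also have "(\<Sum>k<N. \<Sum>g\<in>functions_with_sum B (N - Suc k). ?F (g(a := Suc k))) =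
      (\<Sum>k<N. card (functions_with_sum B k)) * of_bool (d = i)"
    unfolding Suc' by (subst sum.nat_diff_reindex) (simp add: sum_distrib_right)
  \<comment> \<open>Weak compositions on \<open>B\<close> of totals below \<open>N\<close> are those
    of \<open>N - 1\<close> on \<open>insert a B\<close>, with \<open>a\<close> taking the
    slack.\<close>
  also have "(\<Sum>k<N. card (functions_with_sum B k)) = (N - 1 + d) choose d"
    using card_functions_with_sum_insert[of B a "N - 1"] card_functions_with_sum[of B a "N - 1"]
      B assms(4) by (simp add: lessThan_Suc_atMost[symmetric])
  also have "(\<Sum>g\<in>functions_with_sum B N. of_bool (card (?I B g) = i)) =
      (if i < d then (N - 1 + i) choose i else 0)"
    using Suc.hyps(1)[of B] B by simp
  finally show ?case using Suc.hyps(2) by (cases i d rule: linorder_cases) auto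
qed

section \<open>Hypertrees of complete bipartite graphs\<close>

lemma complete_bipartite_graph_commute:
  "complete_bipartite_graph m n V E \<epsilon> \<Longrightarrow> complete_bipartite_graph n m E V \<epsilon>"
  unfolding complete_bipartite_graph_def bipartite_graph_def
  by (metis Int_commute insert_commute)

text \<open>Every edge has exactly one endpoint in \<open>E\<close>, so the edge sets at the
  hyperedges partition \<open>T\<close>.\<close>

lemma sum_degree_in_colour_class:
  assumes "bipartite_graph V E \<epsilon>" "T \<subseteq> \<epsilon>" "finite T"
  shows "(\<Sum>e\<in>E. degree_in T e) = card T"
proof -
  have edge: "\<And>a. a \<in> T \<Longrightarrow> \<exists>v\<in>V. \<exists>e\<in>E. a = {v, e}" and disj: "V \<inter> E = {}" "finite E"
    using assms unfolding bipartite_graph_def by blast+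
  have "card (\<Union>e\<in>E. {a \<in> T. e \<in> a}) = (\<Sum>e\<in>E. card {a \<in> T. e \<in> a})"
    using assms(3) disj(2)
  proof (intro card_UN_disjoint ballI impI)
    fix e e' assume "e \<in> E" "e' \<in> E" "e \<noteq> e'"
    then show "{a \<in> T. e \<in> a} \<inter> {a \<in> T. e' \<in> a} = {}"
      using edge disj(1) by fastforce
  qed auto
  moreover have "(\<Union>e\<in>E. {a \<in> T. e \<in> a}) = T" using edge by fastforce
  ultimately show ?thesis by (simp add: degree_in_def)
qed

lemma hypertree_complete_iff:
  assumes K: "complete_bipartite_graph m n V E \<epsilon>"
  shows "hypertree V E \<epsilon> f \<longleftrightarrow> f \<in> functions_with_sum E (m - 1)"
proof -
  have bip: "bipartite_graph V E \<epsilon>" and VE: "finite V" "finite E" "V \<noteq> {}" "V \<inter> E = {}"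
    and edge: "\<And>a. a \<in> \<epsilon> \<Longrightarrow> \<exists>v\<in>V. \<exists>e\<in>E. a = {v, e}"
    and card: "card V = m" "card E = n" and full: "\<And>v e. v \<in> V \<Longrightarrow> e \<in> E \<Longrightarrow> {v, e} \<in> \<epsilon>"
    using K unfolding complete_bipartite_graph_def bipartite_graph_def by blast+
  \<comment> \<open>This makes the truncated \<open>m - 1\<close> an honest predecessor.\<close>
  have "0 < m" using VE card by auto
  show ?thesis
  proof
    assume "hypertree V E \<epsilon> f"
    then obtain T where f: "f \<in> extensional E" and T: "T \<subseteq> \<epsilon>" "is_tree (V \<union> E) T"
      "\<And>e. e \<in> E \<Longrightarrow> degree_in T e = f e + 1"
      unfolding hypertree_def is_spanning_tree_def by blast
    have edge': "\<exists>u\<in>V \<union> E. \<exists>v\<in>V \<union> E. u \<noteq> v \<and> a = {u, v}" if "a \<in> T" for a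
    proof -
      obtain v e where "v \<in> V" "e \<in> E" "a = {v, e}" using edge \<open>a \<in> T\<close> T(1) by blast
      moreover from this have "v \<noteq> e" using VE(4) by blast
      ultimately show ?thesis by blast
    qed
    have "T \<subseteq> Pow (V \<union> E)" using edge' by fastforce
    then have "finite T" by (rule finite_subset) (use VE in simp)
    then have "card T + 1 = card (V \<union> E)"
      using tree_card_edges[OF T(2) _ _ edge'] VE by simp
    also have "\<dots> = m + n" using VE card by (simp add: card_Un_disjoint)
    \<comment> \<open>The degrees in \<open>E\<close> sum to the number \<open>m + n - 1\<close> of
      tree edges; removing one for each of the \<open>n\<close> hyperedges leaves
      \<open>m - 1\<close>.\<close>
    finally have "(\<Sum>e\<in>E. f e + 1) + 1 = m + n"
      using sum_degree_in_colour_class[OF bip T(1) \<open>finite T\<close>] T(3) by simp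
    moreover have "(\<Sum>e\<in>E. f e + 1) = sum f E + n"
      unfolding sum.distrib using card by simp
    ultimately have "sum f E = m - 1" by simp
    with f show "f \<in> functions_with_sum E (m - 1)" by (simp add: functions_with_sum_def)
  next
    assume f: "f \<in> functions_with_sum E (m - 1)"
    then have "card V = sum f E + 1" using card \<open>0 < m\<close> by (simp add: functions_with_sum_def)
    then obtain T where T: "is_tree (V \<union> E) T" "T \<subseteq> {{v, e} | v e. v \<in> V \<and> e \<in> E}"
      "\<forall>e\<in>E. degree_in T e = f e + 1"
      using exists_bipartite_tree_with_degrees[OF VE(2,1,4)] by blast
    moreover have "T \<subseteq> \<epsilon>" using T(2) full by fastforce
    moreover have "f \<in> extensional E" using f by (simp add: functions_with_sum_def)
    ultimately show "hypertree V E \<epsilon> f"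
      unfolding hypertree_def is_spanning_tree_def by blast
  qed
qed

text \<open>A transfer preserves the sum over \<open>E\<close>, and the sum is the only constraint
  on hypertrees here.\<close>

lemma can_transfer_complete_iff:
  assumes K: "complete_bipartite_graph m n V E \<epsilon>" and f: "hypertree V E \<epsilon> f"
  shows "can_transfer V E \<epsilon> f e e' \<longleftrightarrow> e \<in> E \<and> e' \<in> E \<and> e \<noteq> e' \<and> 1 \<le> f e"
proof -
  have "finite E" using K unfolding complete_bipartite_graph_def bipartite_graph_def by blast
  have "hypertree V E \<epsilon> (f(e := f e - 1, e' := f e' + 1))"
    if e: "e \<in> E" "e' \<in> E" "e \<noteq> e'" "1 \<le> f e"
  proof -
    let ?g = "f(e := f e - 1, e' := f e' + 1)"
    have split: "sum h E = h e + (h e' + sum h (E - {e} - {e'}))" for h :: "'a \<Rightarrow> nat"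
      using e \<open>finite E\<close> by (simp add: sum.remove[of E e] sum.remove[of "E - {e}" e'])
    have "sum ?g (E - {e} - {e'}) = sum f (E - {e} - {e'})" by (intro sum.cong) auto
    then have "sum ?g E = sum f E" using split[of ?g] split[of f] e by simp
    then show ?thesis using f e
      unfolding hypertree_complete_iff[OF K] functions_with_sum_def extensional_def by auto
  qed
  then show ?thesis unfolding can_transfer_def by blast
qed

section \<open>Coefficients of the two polynomials\<close>

lemma coeff_interior_poly_complete:
  assumes K: "complete_bipartite_graph m n V E \<epsilon>" and r: "linear_order_on E r"
  shows "coeff (interior_poly V E \<epsilon> r) i = int (((n - 1) choose i) * ((m - 1) choose i))"
proof -
  have E: "finite E" "E \<noteq> {}" "card E = n"
    using K unfolding complete_bipartite_graph_def bipartite_graph_def by blast+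
  obtain a where a: "a \<in> E" "\<forall>b\<in>E. (a, b) \<in> r"
    using linear_order_on_finite_least[OF r E(1,2)] by auto
  define A where "A = E - {a}"
  have A: "finite A" "a \<notin> A" "E = insert a A" "card A = n - 1" using a E by (auto simp: A_def)
  have anti: "(b, a) \<notin> r" if "b \<in> A" for b
    using that a A r by (metis order_on_defs(1-3) antisymD insertCI)
  \<comment> \<open>The least hyperedge \<open>a\<close> has nothing below it, and every other
    hyperedge with positive value can transfer to \<open>a\<close>.\<close>
  have inactive: "{e \<in> E. internally_inactive V E \<epsilon> r f e} = {e \<in> A. 1 \<le> f e}"
    if "hypertree V E \<epsilon> f" for f
    unfolding internally_inactive_def can_transfer_complete_iff[OF K that]
    using a A(3,2) anti by auto
  have "coeff (interior_poly V E \<epsilon> r) i =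
    (\<Sum>f | hypertree V E \<epsilon> f. of_bool (card {e \<in> A. 1 \<le> f e} = i))"
    unfolding interior_poly_def coeff_sum by (intro sum.cong) (auto simp: inactive)
  also have "\<dots> = int (\<Sum>f\<in>functions_with_sum E (m - 1). of_bool (card {e \<in> A. 1 \<le> f e} = i))"
    unfolding hypertree_complete_iff[OF K] by simp
  also have "\<dots> = int (((n - 1) choose i) * ((m - 1) choose i))"
    using card_functions_with_sum_support[OF A(1,2), of i "m - 1"] A(3,4) by presburger
  finally show ?thesis .
qed

lemma coeff_exterior_poly_complete:
  assumes K: "complete_bipartite_graph m n V E \<epsilon>" and r: "linear_order_on E r"
  shows "coeff (exterior_poly V E \<epsilon> r) i = (if i < n then int ((m + i - 2) choose i) else 0)"
proof -
  have E: "finite E" "E \<noteq> {}" "card E = n" and V: "finite V" "V \<noteq> {}" "card V = m"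
    using K unfolding complete_bipartite_graph_def bipartite_graph_def by blast+
  have "0 < n" "0 < m" using E V by auto
  let ?I = "\<lambda>f. {e \<in> E. \<exists>e'\<in>E. (e', e) \<in> r \<and> e' \<noteq> e \<and> 1 \<le> (f e' :: nat)}"
  have inactive: "{e \<in> E. externally_inactive V E \<epsilon> r f e} = ?I f" if "hypertree V E \<epsilon> f" for f
    unfolding externally_inactive_def can_transfer_complete_iff[OF K that] by auto
  have "coeff (exterior_poly V E \<epsilon> r) i =
    (\<Sum>f | hypertree V E \<epsilon> f. of_bool (card (?I f) = i))"
    unfolding exterior_poly_def coeff_sum by (intro sum.cong) (auto simp: inactive)
  also have "\<dots> = int (\<Sum>f\<in>functions_with_sum E (m - 1). of_bool (card (?I f) = i))"
    unfolding hypertree_complete_iff[OF K] by simp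
  also have "(\<Sum>f\<in>functions_with_sum E (m - 1). of_bool (card (?I f) = i)) =
    (if i < n then (m + i - 2) choose i else 0)"
  \<comment> \<open>For \<open>m = 1\<close> the zero function is the only hypertree and has empty
    support, so it is treated apart. The truncated formula still fits: it gives
    \<open>0 choose 0 = 1\<close> at \<open>i = 0\<close> and \<open>(i - 1) choose i = 0\<close>
    afterwards.\<close>
  proof (cases "m = 1")
    case True
    have "(\<Sum>f\<in>functions_with_sum E 0. of_bool (card (?I f) = i) :: nat) =
      (\<Sum>f\<in>functions_with_sum E 0. of_bool (i = 0))"
    proof (intro sum.cong)
      fix f assume "f \<in> functions_with_sum E 0"
      then have "?I f = {}" using E(1) by (auto simp: functions_with_sum_def)
      then have "card (?I f) = 0" by (simp only: card.empty)
      then show "of_bool (card (?I f) = i) = (of_bool (i = 0) :: nat)" by (simp only: eq_commute)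
    qed simp
    moreover have "card (functions_with_sum E 0) = 1"
    proof -
      obtain a where "a \<in> E" using E by blast
      then show ?thesis using card_functions_with_sum[of "E - {a}" a 0] E
        by (simp add: insert_absorb)
    qed
    ultimately show ?thesis using True \<open>0 < n\<close> by (cases i) auto
  next
    case False
    then have "1 \<le> m - 1" "m - 1 - 1 + i = m + i - 2" using \<open>0 < m\<close> by auto
    then show ?thesis using card_functions_with_sum_above[OF r E(1) subset_refl, where N = "m - 1" and i = i] E(3)
      by simp
  qed
  finally show ?thesis by simp
qed

theorem theorem52:
  fixes V E :: "'a set" and \<epsilon> :: "'a set set" and r s :: "'a rel" and m n :: nat
  assumes "complete_bipartite_graph m n V E \<epsilon>"
    and "m \<le> n"
    and "linear_order_on E r"
    and "linear_order_on V s"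
  shows "interior_poly V E \<epsilon> r =
           (\<Sum>i=0..m-1. monom (int (((n - 1) choose i) * ((m - 1) choose i))) i)
       \<and> interior_poly E V \<epsilon> s =
           (\<Sum>i=0..m-1. monom (int (((n - 1) choose i) * ((m - 1) choose i))) i)
       \<and> exterior_poly V E \<epsilon> r =
           (\<Sum>i=0..n-1. monom (int ((m + i - 2) choose i)) i)"
proof -
  note K = assms(1)
  have "0 < n" using K unfolding complete_bipartite_graph_def bipartite_graph_def by auto
  have coeff_sum_monom: "coeff (\<Sum>i=0..d. monom (c i) i) j = (if j \<le> d then c j else 0)"
    for c :: "nat \<Rightarrow> int" and d j
    by (simp add: coeff_sum)
  \<comment> \<open>All three identities are compared coefficientwise. The interior formula is
    symmetric in \<open>m\<close> and \<open>n\<close>, so swapping the colour classes yields the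
    second one; beyond degree \<open>m - 1\<close> the factor \<open>(m - 1) choose i\<close>
    vanishes.\<close>
  show ?thesis
    unfolding poly_eq_iff coeff_sum_monom coeff_interior_poly_complete[OF K assms(3)]
      coeff_interior_poly_complete[OF complete_bipartite_graph_commute[OF K] assms(4)]
      coeff_exterior_poly_complete[OF K assms(3)]
    using \<open>0 < n\<close> by (auto simp: binomial_eq_0)
qed

end
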